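(* Let $\exp U\in\mathrm{Aut}(N)$, where $U$ is a derivation of $\mathfrak n$, be such that $[U,X_i]=0$ and $[U,Y_i]=\ln(2)Y_i$ for all $i$ with $1\le i\le d$. Then there exists a matrix representation of the linear adjoint action of $\mathbb RU$ in $\mathfrak{gl}(\mathfrak n)$ such that $$ad_U=\begin{pmatrix}\ln(2)\mathbf I_{n-2d}&\mathbf 0&\mathbf 0\\ \mathbf 0&\ln(2)\mathbf I_d&\mathbf 0\\ \mathbf 0&\mathbf 0&\mathbf 0_d\end{pmatrix}\quad\text{and}\quad Ad_{\exp U}=\begin{pmatrix}2\mathbf I_{n-2d}&\mathbf 0&\mathbf 0\\ \mathbf 0&2\mathbf I_d&\mathbf 0\\ \mathbf 0&\mathbf 0&\mathbf I_d\end{pmatrix},$$ where $ad_U$ is the derivative of $Ad_{\exp U}$.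
   Context: $N$ is a simply connected, connected, non-commutative nilpotent Lie group with Lie algebra $\mathfrak n$ of dimension $n$ over $\mathbb R$, with a rational structure (i.e. $\mathfrak n$ has an $\mathbb R$-basis with rational structure constants, whose $\mathbb Q$-span $\mathfrak n_{\mathbb Q}$ satisfies $\mathfrak n\cong\mathfrak n_{\mathbb Q}\otimes\mathbb R$). Fix an ordered Jordan-Hölder basis $J=\{B_1,\dots,B_n\}=\{Z_1,\dots,Z_{n-2d},Y_1,\dots,Y_d,X_1,\dots,X_d\}$ of $\mathfrak n$ (the span of each initial segment is an ideal) such that: (C1) $\mathfrak n=\mathfrak z(\mathfrak n)\oplus\mathfrak a\oplus\mathfrak b$, where $\mathfrak z(\mathfrak n)=\mathrm{span}_{\mathbb R}\{Z_1,\dots,Z_{n-2d}\}$ is the center of $\mathfrak n$, $\mathfrak a=\mathrm{span}_{\mathbb R}\{Y_1,\dots,Y_d\}$ and $\mathfrak b=\mathrm{span}_{\mathbb R}\{X_1,\dots,X_d\}$; (C2) $\mathfrak z(\mathfrak n)\oplus\mathfrak a$ is a commutative ideal of $\mathfrak n$, and $\mathfrak b$ is a commutative subalgebra (not an ideal) of $\mathfrak n$ such that $[\mathfrak a,\mathfrak b]\subseteq\mathfrak z(\mathfrak n)$; (C3) the only possibly nonzero brackets of basis elements are $[X_i,Y_j]=-[Y_j,X_i]$, and for the matrix $V=([X_i,Y_j])_{1\le i,j\le d}$, $\det V$ is a nonzero polynomial with rational coefficients defined over $[\mathfrak n,\mathfrak n]$. For a derivation $U$ of $\mathfrak n$ and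 $W\in\mathfrak n$, $[U,W]$ denotes $U(W)$; $ad_U$ is the linear map $W\mapsto[U,W]$ of $\mathfrak n$, and $Ad_{\exp U}=\exp(ad_U)$. The matrix blocks correspond, in order, to $Z_1,\dots,Z_{n-2d}$, to $Y_1,\dots,Y_d$, and to $X_1,\dots,X_d$. $\mathbf I_q$ is the identity matrix of order $q$, and $\mathbf 0_d$ is the zero matrix of order $d$.
   Formalization: The formal version also assumes that the center is contained in [n,n] (each Z_k lies in [n,n]); without this the claim fails, e.g. for Heisenberg ⊕ ℝZ_2 with [U,Z_2]=0. *)

theory Defs
  imports
    "HOL-Analysis.Analysis"
    "HOL-Library.Poly_Mapping"
    "Jordan_Normal_Form.Determinant"
begin

text \<open>
  A finite-dimensional real Lie algebra is given by a bracket on a type of class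
  \<open>euclidean_space\<close>. The inner product of that class is auxiliary: it only supplies the topology.
\<close>

definition lie_algebra :: "('a::euclidean_space \<Rightarrow> 'a \<Rightarrow> 'a) \<Rightarrow> bool" where
  "lie_algebra br \<longleftrightarrow> bilinear br \<and> (\<forall>x. br x x = 0) \<and>
     (\<forall>x y z. br x (br y z) + br y (br z x) + br z (br x y) = 0)"

fun lower_central :: "('a::euclidean_space \<Rightarrow> 'a \<Rightarrow> 'a) \<Rightarrow> nat \<Rightarrow> 'a set" where
  "lower_central br 0 = UNIV"
| "lower_central br (Suc k) = span {br x y | x y. y \<in> lower_central br k}"

definition nilpotent_lie_algebra :: "('a::euclidean_space \<Rightarrow> 'a \<Rightarrow> 'a) \<Rightarrow> bool" where
  "nilpotent_lie_algebra br \<longleftrightarrow> lie_algebra br \<and> (\<exists>k. lower_central br k = {0})"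

definition derived_algebra :: "('a::euclidean_space \<Rightarrow> 'a \<Rightarrow> 'a) \<Rightarrow> 'a set" where
  "derived_algebra br = span {br x y | x y. True}"

definition lie_center :: "('a::euclidean_space \<Rightarrow> 'a \<Rightarrow> 'a) \<Rightarrow> 'a set" where
  "lie_center br = {x. \<forall>y. br x y = 0}"

definition lie_subalgebra :: "('a::euclidean_space \<Rightarrow> 'a \<Rightarrow> 'a) \<Rightarrow> 'a set \<Rightarrow> bool" where
  "lie_subalgebra br S \<longleftrightarrow> subspace S \<and> (\<forall>x\<in>S. \<forall>y\<in>S. br x y \<in> S)"

definition lie_ideal :: "('a::euclidean_space \<Rightarrow> 'a \<Rightarrow> 'a) \<Rightarrow> 'a set \<Rightarrow> bool" where
  "lie_ideal br S \<longleftrightarrow> subspace S \<and> (\<forall>x. \<forall>y\<in>S. br x y \<in> S)"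

definition commutative_on :: "('a::euclidean_space \<Rightarrow> 'a \<Rightarrow> 'a) \<Rightarrow> 'a set \<Rightarrow> bool" where
  "commutative_on br S \<longleftrightarrow> (\<forall>x\<in>S. \<forall>y\<in>S. br x y = 0)"

definition ordered_basis :: "'a::euclidean_space list \<Rightarrow> bool" where
  "ordered_basis J \<longleftrightarrow> distinct J \<and> independent (set J) \<and> span (set J) = UNIV"

definition jordan_hoelder_basis :: "('a::euclidean_space \<Rightarrow> 'a \<Rightarrow> 'a) \<Rightarrow> 'a list \<Rightarrow> bool" where
  "jordan_hoelder_basis br J \<longleftrightarrow> ordered_basis J \<and>
     (\<forall>k\<le>length J. lie_ideal br (span (set (take k J))))"

definition rational_structure :: "('a::euclidean_space \<Rightarrow> 'a \<Rightarrow> 'a) \<Rightarrow> bool" where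
  "rational_structure br \<longleftrightarrow> (\<exists>E. independent E \<and> span E = UNIV \<and>
     (\<forall>x\<in>E. \<forall>y\<in>E. \<forall>z\<in>E. representation E (br x y) z \<in> \<rat>))"

definition derivation :: "('a::euclidean_space \<Rightarrow> 'a \<Rightarrow> 'a) \<Rightarrow> ('a \<Rightarrow> 'a) \<Rightarrow> bool" where
  "derivation br U \<longleftrightarrow> linear U \<and> (\<forall>x y. U (br x y) = br (U x) y + br x (U y))"

text \<open>For a derivation \<open>U\<close>, the bracket \<open>[U, W]\<close> is \<open>U W\<close> (semidirect product bracket).\<close>

definition ad :: "('a::euclidean_space \<Rightarrow> 'a) \<Rightarrow> 'a \<Rightarrow> 'a" where
  "ad U = (\<lambda>W. U W)"

text \<open>
  The operator exponential, summed pointwise; the series converges for every linear operator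
  because the space is finite-dimensional.
\<close>

definition lin_exp :: "('a::euclidean_space \<Rightarrow> 'a) \<Rightarrow> 'a \<Rightarrow> 'a" where
  "lin_exp T W = suminf (\<lambda>k. (1 / fact k) *\<^sub>R (T ^^ k) W)"

definition Ad_exp :: "('a::euclidean_space \<Rightarrow> 'a) \<Rightarrow> 'a \<Rightarrow> 'a" where
  "Ad_exp U = lin_exp (ad U)"

text \<open>
  \<open>N\<close> is a Lie group with Lie algebra \<open>br\<close> and exponential map \<open>expN\<close>: a topological group
  for which \<open>expN\<close> is a local homeomorphism at 0 satisfying the Baker-Campbell-Hausdorff formula.
  The formula is truncated after the first bracket: \<open>condition_C1\<close> and \<open>condition_C2\<close> make the algebra
  two-step nilpotent, and for a nilpotent algebra the formula holds globally.
  Connectedness and simple connectedness of \<open>N\<close> are separate conditions.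
\<close>

definition lie_group_of ::
  "('g::t2_space) monoid \<Rightarrow> ('a::euclidean_space \<Rightarrow> 'a \<Rightarrow> 'a) \<Rightarrow> ('a \<Rightarrow> 'g) \<Rightarrow> bool" where
  "lie_group_of N br expN \<longleftrightarrow>
     group N \<and>
     continuous_on (carrier N \<times> carrier N) (\<lambda>p. fst p \<otimes>\<^bsub>N\<^esub> snd p) \<and>
     continuous_on (carrier N) (\<lambda>g. inv\<^bsub>N\<^esub> g) \<and>
     range expN \<subseteq> carrier N \<and>
     continuous_on UNIV expN \<and>
     (\<forall>x y. expN x \<otimes>\<^bsub>N\<^esub> expN y = expN (x + y + (1/2) *\<^sub>R br x y)) \<and>
     (\<exists>S T f. open S \<and> 0 \<in> S \<and> openin (top_of_set (carrier N)) T \<and> homeomorphism S T expN f)"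

text \<open>Automorphisms of a Lie group; continuous homomorphisms of Lie groups are smooth.\<close>

definition lie_Aut :: "('g::t2_space) monoid \<Rightarrow> ('g \<Rightarrow> 'g) set" where
  "lie_Aut N = {\<phi> \<in> iso N N. \<exists>\<psi>. homeomorphism (carrier N) (carrier N) \<phi> \<psi>}"

definition condition_C1 ::
  "('a::euclidean_space \<Rightarrow> 'a \<Rightarrow> 'a) \<Rightarrow> 'a list \<Rightarrow> 'a list \<Rightarrow> 'a list \<Rightarrow> bool" where
  "condition_C1 br Zs Ys Xs \<longleftrightarrow>
     lie_center br = span (set Zs) \<and>
     (\<forall>w. \<exists>!t. t \<in> lie_center br \<times> span (set Ys) \<times> span (set Xs) \<and>
            w = fst t + fst (snd t) + snd (snd t))"

definition condition_C2 ::
  "('a::euclidean_space \<Rightarrow> 'a \<Rightarrow> 'a) \<Rightarrow> 'a list \<Rightarrow> 'a list \<Rightarrow> 'a list \<Rightarrow> bool" where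
  "condition_C2 br Zs Ys Xs \<longleftrightarrow>
     lie_ideal br (span (set Zs \<union> set Ys)) \<and> commutative_on br (span (set Zs \<union> set Ys)) \<and>
     lie_subalgebra br (span (set Xs)) \<and> commutative_on br (span (set Xs)) \<and>
     \<not> lie_ideal br (span (set Xs)) \<and>
     (\<forall>y\<in>span (set Ys). \<forall>x\<in>span (set Xs). br y x \<in> lie_center br)"

text \<open>
  Real polynomials in unknowns indexed by \<open>nat\<close> are elements of the monoid algebra
  \<open>(nat \<Rightarrow>\<^sub>0 nat) \<Rightarrow>\<^sub>0 real\<close>; the \<open>k\<close>-th unknown stands for the basis vector
  \<open>Zs ! k\<close>. As the brackets \<open>[X\<^sub>i, Y\<^sub>j]\<close> are central, expanding them in the basis makes
  the entries of \<open>V\<close> linear forms in these unknowns.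
\<close>

definition bracket_matrix ::
  "('a::euclidean_space \<Rightarrow> 'a \<Rightarrow> 'a) \<Rightarrow> 'a list \<Rightarrow> 'a list \<Rightarrow> 'a list
     \<Rightarrow> ((nat \<Rightarrow>\<^sub>0 nat) \<Rightarrow>\<^sub>0 real) Matrix.mat" where
  "bracket_matrix br Zs Ys Xs = Matrix.mat (length Xs) (length Ys) (\<lambda>(i, j).
     \<Sum>k<length Zs. Poly_Mapping.single (Poly_Mapping.single k 1)
       (representation (set (Zs @ Ys @ Xs)) (br (Xs ! i) (Ys ! j)) (Zs ! k)))"

text \<open>
  That \<open>det V\<close>, a polynomial in the unknowns \<open>Z\<^sub>1, Z\<^sub>2, \<dots>\<close>, is defined over
  \<open>[n, n]\<close> means that its unknowns belong to \<open>[n, n]\<close>. Only asking that \<open>det V\<close> be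
  a polynomial in elements of \<open>[n, n]\<close> would be void, because the entries of \<open>V\<close> are brackets.
\<close>

definition condition_C3 ::
  "('a::euclidean_space \<Rightarrow> 'a \<Rightarrow> 'a) \<Rightarrow> 'a list \<Rightarrow> 'a list \<Rightarrow> 'a list \<Rightarrow> bool" where
  "condition_C3 br Zs Ys Xs \<longleftrightarrow>
     (\<forall>u\<in>set (Zs @ Ys @ Xs). \<forall>v\<in>set (Zs @ Ys @ Xs). br u v \<noteq> 0 \<longrightarrow>
        (u \<in> set Xs \<and> v \<in> set Ys) \<or> (u \<in> set Ys \<and> v \<in> set Xs)) \<and>
     Determinant.det (bracket_matrix br Zs Ys Xs) \<noteq> 0 \<and>
     (\<forall>m. Poly_Mapping.lookup (Determinant.det (bracket_matrix br Zs Ys Xs)) m \<in> \<rat>) \<and>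
     set Zs \<subseteq> derived_algebra br"

text \<open>
  \<open>\<Phi>\<close> is the matrix representation of the linear operators with respect to the ordered basis
  \<open>J\<close>: column \<open>j\<close> of \<open>\<Phi> T\<close> holds the coordinates of \<open>T (J ! j)\<close>.
\<close>

definition matrix_representation ::
  "'a::euclidean_space list \<Rightarrow> (('a \<Rightarrow> 'a) \<Rightarrow> real Matrix.mat) \<Rightarrow> bool" where
  "matrix_representation J \<Phi> \<longleftrightarrow> (\<forall>T. linear T \<longrightarrow>
     \<Phi> T \<in> carrier_mat (length J) (length J) \<and>
     (\<forall>j<length J. T (J ! j) = (\<Sum>i<length J. (\<Phi> T $$ (i, j)) *\<^sub>R (J ! i))))"

end

theory Submission
  imports Defs
begin

text \<open>
  On basis vectors the bracket is nonzero only between some \<open>X\<^sub>i\<close> and some \<open>Y\<^sub>j\<close>, so the Leibniz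
  rule and bilinearity make \<open>U\<close> act as \<open>ln 2\<close> on every bracket, hence on the derived algebra,
  which contains all \<open>Z\<^sub>k\<close>. Thus \<open>U\<close> is diagonal with eigenvalues \<open>ln 2\<close> and \<open>0\<close>, so
  \<open>U \<circ> U = ln 2 \<cdot> U\<close>, and the exponential series of \<open>t U\<close> collapses to
  \<open>W + (2\<^sup>t - 1) / ln 2 \<cdot> U W\<close>.
\<close>

text \<open>Every positive power of \<open>t U\<close> sends \<open>W\<close> to a multiple of the
  same vector \<open>U W\<close>, so beyond its constant term the series is a scalar exponential
  series in \<open>t * c\<close>, divided by \<open>c\<close>.\<close>

lemma lin_exp_scaled_quasi_idempotent:
  fixes U :: "'a::euclidean_space \<Rightarrow> 'a"
  assumes "linear U" and UU: "U (U W) = c *\<^sub>R U W" and "c \<noteq> 0"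
  shows "lin_exp (\<lambda>V. t *\<^sub>R U V) W = W + ((exp (t * c) - 1) / c) *\<^sub>R U W"
proof -
  interpret U: linear U by fact
  have pow: "((\<lambda>V. t *\<^sub>R U V) ^^ Suc k) W = (t ^ Suc k * c ^ k) *\<^sub>R U W" for k
    by (induction k) (simp_all add: U.scale UU mult_ac)
  \<comment> \<open>\<open>?E\<close> is the full exponential series times
    \<open>(1 / c) U W\<close>. It agrees with the operator series except at \<open>k = 0\<close>,
    where that series has \<open>W\<close>; \<open>?A\<close> carries the difference.\<close>
  let ?A = "\<lambda>k::nat. if k = 0 then W - (1 / c) *\<^sub>R U W else 0"
  let ?E = "\<lambda>k. ((t * c) ^ k /\<^sub>R fact k) *\<^sub>R ((1 / c) *\<^sub>R U W)"
  have eq: "(1 / fact k) *\<^sub>R ((\<lambda>V. t *\<^sub>R U V) ^^ k) W = ?A k + ?E k" for k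
  proof (cases k)
    case (Suc m)
    show ?thesis unfolding Suc pow using \<open>c \<noteq> 0\<close>
      by (simp add: power_mult_distrib field_simps)
  qed simp
  have "?A sums (W - (1 / c) *\<^sub>R U W)"
    using sums_single[of 0 "\<lambda>_. W - (1 / c) *\<^sub>R U W"] by simp
  moreover have "?E sums (exp (t * c) *\<^sub>R ((1 / c) *\<^sub>R U W))"
    by (intro sums_scaleR_left exp_converges)
  ultimately have "(\<lambda>k. ?A k + ?E k) sums
      (W - (1 / c) *\<^sub>R U W + exp (t * c) *\<^sub>R ((1 / c) *\<^sub>R U W))"
    by (rule sums_add)
  then show ?thesis
    unfolding lin_exp_def eq by (simp add: sums_unique[symmetric] algebra_simps diff_divide_distrib)
qed

text \<open>This gives the sense in which \<open>ad U\<close> is the derivative of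
  \<open>Ad\<close>: the velocity at the identity of the one-parameter group generated by
  \<open>U\<close>. In the closed form only the coefficient of \<open>U W\<close> varies, with slope
  1 at 0.\<close>

lemma lin_exp_scaled_has_vector_derivative:
  fixes U :: "'a::euclidean_space \<Rightarrow> 'a"
  assumes "linear U" and "U (U W) = c *\<^sub>R U W" and "c \<noteq> 0"
  shows "((\<lambda>t. lin_exp (\<lambda>V. t *\<^sub>R U V) W) has_vector_derivative U W) (at 0)"
proof -
  have "((\<lambda>t. (exp (t * c) - 1) / c) has_real_derivative 1) (at 0)"
    using \<open>c \<noteq> 0\<close> by (auto intro!: derivative_eq_intros)
  from has_vector_derivative_add[OF has_vector_derivative_const
      has_vector_derivative_scaleR[OF this has_vector_derivative_const]]
  have "((\<lambda>t. W + ((exp (t * c) - 1) / c) *\<^sub>R U W) has_vector_derivative U W) (at 0)"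
    by simp
  then show ?thesis
    unfolding lin_exp_scaled_quasi_idempotent[OF assms] .
qed

text \<open>The Leibniz rule adds eigenvalues. The pairs 0, \<open>ln 2\<close> and
  \<open>ln 2\<close>, 0 both give \<open>ln 2\<close>.\<close>

lemma derivation_eigenvector_bracket:
  assumes "lie_algebra br" and "derivation br U"
    and "U x = a *\<^sub>R x" and "U y = b *\<^sub>R y"
  shows "U (br x y) = (a + b) *\<^sub>R br x y"
proof -
  have bl: "bilinear br"
    using assms(1) by (simp add: lie_algebra_def)
  have "U (br x y) = br (U x) y + br x (U y)"
    using assms(2) by (simp add: derivation_def)
  then show ?thesis
    by (simp add: assms(3,4) bilinear_lmul[OF bl] bilinear_rmul[OF bl] scaleR_add_left)
qed

text \<open>The eigenvector equation for \<open>br x y\<close> is linear in each argument, so it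
  passes from basis pairs to all pairs, one argument at a time, and then to the span of all
  brackets.\<close>

lemma derived_algebra_eigenvector:
  assumes bl: "bilinear br" and "linear U" and spn: "span B = UNIV"
    and brB: "\<And>u v. u \<in> B \<Longrightarrow> v \<in> B \<Longrightarrow> U (br u v) = c *\<^sub>R br u v"
    and "z \<in> derived_algebra br"
  shows "U z = c *\<^sub>R z"
proof -
  interpret U: linear U by fact
  \<comment> \<open>Stated for arbitrary linear \<open>f\<close> because three instances occur: the
    bracket with either argument fixed, and the identity.\<close>
  have sub: "linear f \<Longrightarrow> subspace {x. U (f x) = c *\<^sub>R f x}" for f :: "'a \<Rightarrow> 'a"
    by (auto simp: subspace_def linear_add linear_0 linear_scale U.add U.scale U.zero
        algebra_simps)
  have l: "linear (\<lambda>x. br x y)" "linear (br x)" for x y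
    using bl by (auto simp: bilinear_def)
  have "U (br u y) = c *\<^sub>R br u y" if "u \<in> B" for u y
    using span_minimal[OF _ sub[OF l(2)[of u]], of B] brB that spn by auto
  then have br: "U (br x y) = c *\<^sub>R br x y" for x y
    using span_minimal[OF _ sub[OF l(1)[of y]], of B] spn by auto
  have "derived_algebra br \<subseteq> {z. U z = c *\<^sub>R z}"
    unfolding derived_algebra_def
    using sub[OF linear_ident] by (intro span_minimal) (auto simp: br)
  then show ?thesis
    using assms(5) by auto
qed

definition basis_matrix :: "'a::euclidean_space list \<Rightarrow> ('a \<Rightarrow> 'a) \<Rightarrow> real Matrix.mat" where
  "basis_matrix J T = Matrix.mat (length J) (length J)
     (\<lambda>(i, j). representation (set J) (T (J ! j)) (J ! i))"

lemma matrix_representation_basis_matrix: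
  assumes "ordered_basis J"
  shows "matrix_representation J (basis_matrix J)"
  unfolding matrix_representation_def
proof (intro allI impI conjI)
  fix T :: "'a \<Rightarrow> 'a" and j
  assume j: "j < length J"
  have "(\<Sum>i<length J. (basis_matrix J T $$ (i, j)) *\<^sub>R (J ! i))
      = (\<Sum>i<length J. representation (set J) (T (J ! j)) (J ! i) *\<^sub>R (J ! i))"
    using j by (simp add: basis_matrix_def)
  \<comment> \<open>Distinctness of \<open>J\<close> turns the sum over positions into a sum over
    basis vectors, which is how \<open>representation\<close> indexes coordinates.\<close>
  also have "\<dots> = (\<Sum>b\<in>set J. representation (set J) (T (J ! j)) b *\<^sub>R b)"
    using assms by (intro sum.reindex_bij_betw bij_betw_nth) (auto simp: ordered_basis_def)
  also have "\<dots> = T (J ! j)"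
    using assms by (intro real_vector.sum_representation_eq) (auto simp: ordered_basis_def)
  finally show "T (J ! j) = (\<Sum>i<length J. (basis_matrix J T $$ (i, j)) *\<^sub>R (J ! i))" ..
qed (simp add: basis_matrix_def)

lemma basis_matrix_eigenbasis:
  assumes "ordered_basis J" and "\<And>j. j < length J \<Longrightarrow> T (J ! j) = \<mu> j *\<^sub>R (J ! j)"
  shows "basis_matrix J T =
    Matrix.mat (length J) (length J) (\<lambda>(i, j). if i = j then \<mu> j else 0)"
proof (rule eq_matI)
  fix i j
  assume "i < dim_row (Matrix.mat (length J) (length J) (\<lambda>(i, j). if i = j then \<mu> j else 0))"
    and "j < dim_col (Matrix.mat (length J) (length J) (\<lambda>(i, j). if i = j then \<mu> j else 0))"
  then have ij: "i < length J" "j < length J" by auto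
  have indep: "independent (set J)" and "distinct J"
    using assms(1) by (auto simp: ordered_basis_def)
  have "representation (set J) (\<mu> j *\<^sub>R (J ! j)) = (\<lambda>b. \<mu> j * representation (set J) (J ! j) b)"
    using ij by (intro real_vector.representation_scale indep) (auto intro: span_base)
  then show "basis_matrix J T $$ (i, j) =
      Matrix.mat (length J) (length J) (\<lambda>(i, j). if i = j then \<mu> j else 0) $$ (i, j)"
    using ij \<open>distinct J\<close>
    by (auto simp: basis_matrix_def assms(2) real_vector.representation_basis[OF indep]
        nth_eq_iff_index_eq)
qed (simp_all add: basis_matrix_def)

text \<open>Rewrites the block form into the shape that \<open>basis_matrix_eigenbasis\<close>
  produces, so that only eigenvalues remain to be compared.\<close>

lemma diag_block_mat_scalar_blocks:
  fixes a b c :: "'a::semiring_1"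
  shows "diag_block_mat [a \<cdot>\<^sub>m 1\<^sub>m p, b \<cdot>\<^sub>m 1\<^sub>m q, c \<cdot>\<^sub>m 1\<^sub>m r] =
    Matrix.mat (p + q + r) (p + q + r)
      (\<lambda>(i, j). if i = j then if j < p then a else if j < p + q then b else c else 0)"
  by (rule eq_matI) (auto simp: Let_def)

theorem corollary10:
  fixes br :: "'a::euclidean_space \<Rightarrow> 'a \<Rightarrow> 'a"
    and N :: "('g::t2_space) monoid"
    and expN :: "'a \<Rightarrow> 'g"
    and n d :: nat
    and Zs Ys Xs :: "'a list"
    and U :: "'a \<Rightarrow> 'a"
  assumes "nilpotent_lie_algebra br"
    and "\<not> commutative_on br UNIV"
    and "DIM('a) = n"
    and "rational_structure br"
    and "lie_group_of N br expN"
    and "connected (carrier N)"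
    and "simply_connected (carrier N)"
    and "length Zs = n - 2 * d" and "length Ys = d" and "length Xs = d"
    and "jordan_hoelder_basis br (Zs @ Ys @ Xs)"
    and "condition_C1 br Zs Ys Xs"
    and "condition_C2 br Zs Ys Xs"
    and "condition_C3 br Zs Ys Xs"
    and "derivation br U"
    and "\<exists>\<phi>\<in>lie_Aut N. \<forall>W. \<phi> (expN W) = expN (lin_exp U W)"
    and "\<forall>i<d. ad U (Xs ! i) = 0"
    and "\<forall>i<d. ad U (Ys ! i) = ln 2 *\<^sub>R (Ys ! i)"
  shows "\<exists>\<Phi>. matrix_representation (Zs @ Ys @ Xs) \<Phi> \<and>
           \<Phi> (ad U) = diag_block_mat
             [ln 2 \<cdot>\<^sub>m 1\<^sub>m (n - 2 * d), ln 2 \<cdot>\<^sub>m 1\<^sub>m d, 0\<^sub>m d d] \<and>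
           \<Phi> (Ad_exp U) = diag_block_mat
             [2 \<cdot>\<^sub>m 1\<^sub>m (n - 2 * d), 2 \<cdot>\<^sub>m 1\<^sub>m d, 1\<^sub>m d] \<and>
           (\<forall>W. ((\<lambda>t. Ad_exp (\<lambda>V. t *\<^sub>R U V) W) has_vector_derivative ad U W) (at 0))"
proof -
  let ?J = "Zs @ Ys @ Xs"
  have lie: "lie_algebra br" and bl: "bilinear br" and lin: "linear U"
    using assms(1,15) by (auto simp: nilpotent_lie_algebra_def lie_algebra_def derivation_def)
  have ob: "ordered_basis ?J"
    using assms(11) by (simp add: jordan_hoelder_basis_def)
  then have spn: "span (set ?J) = UNIV"
    by (simp add: ordered_basis_def)
  \<comment> \<open>The zero is written as \<open>0 *\<^sub>R x\<close> to match the eigenvector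
    premises of \<open>derivation_eigenvector_bracket\<close>.\<close>
  have X: "U x = 0 *\<^sub>R x" if "x \<in> set Xs" for x
    using that assms(10,17) by (auto simp: ad_def in_set_conv_nth)
  have Y: "U y = ln 2 *\<^sub>R y" if "y \<in> set Ys" for y
    using that assms(9,18) by (auto simp: ad_def in_set_conv_nth)
  have "U (br u v) = ln 2 *\<^sub>R br u v" if uv: "u \<in> set ?J" "v \<in> set ?J" for u v
  proof (cases "br u v = 0")
    case True
    then show ?thesis by (simp add: linear_0[OF lin])
  next
    case False
    then have "(u \<in> set Xs \<and> v \<in> set Ys) \<or> (u \<in> set Ys \<and> v \<in> set Xs)"
      using assms(14) uv unfolding condition_C3_def by blast
    then show ?thesis
      using derivation_eigenvector_bracket[OF lie assms(15)] X Y by fastforce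
  qed
  moreover have "set Zs \<subseteq> derived_algebra br"
    using assms(14) by (simp add: condition_C3_def)
  \<comment> \<open>The action on the center is not prescribed; it is forced because the
    \<open>Zs\<close> lie in the derived algebra.\<close>
  ultimately have Z: "U z = ln 2 *\<^sub>R z" if "z \<in> set Zs" for z
    using derived_algebra_eigenvector[OF bl lin spn] that by blast
  \<comment> \<open>Both sides are linear in \<open>W\<close>, and both eigenvalues 0 and
    \<open>ln 2\<close> satisfy \<open>s * s = ln 2 * s\<close>.\<close>
  have UU: "U (U W) = ln 2 *\<^sub>R U W" for W
  proof -
    have "linear (\<lambda>W. U (U W))" "linear (\<lambda>W. ln 2 *\<^sub>R U W)"
      using linear_compose[OF lin lin] lin by (auto simp: o_def intro: linear_compose_scale_right)
    moreover have "U (U b) = ln 2 *\<^sub>R U b" if "b \<in> set ?J" for b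
      using that X Y Z by (auto simp: linear_scale[OF lin] linear_0[OF lin])
    ultimately show ?thesis
      using linear_eq_on_span[where B = "set ?J" and x = W] spn by auto
  qed
  have Ad: "Ad_exp (\<lambda>V. t *\<^sub>R U V) W = W + ((exp (t * ln 2) - 1) / ln 2) *\<^sub>R U W" for t W
    unfolding Ad_exp_def ad_def using lin_exp_scaled_quasi_idempotent[OF lin UU] by simp
  \<comment> \<open>At \<open>t = 1\<close> the numerator is
    \<open>exp (ln 2) - 1 = 1\<close>.\<close>
  have Ad1: "Ad_exp U W = W + (1 / ln 2) *\<^sub>R U W" for W
    using Ad[of 1 W] by simp
  have len: "length ?J = n - 2 * d + d + d"
    using assms(8-10) by simp
  \<comment> \<open>The first two blocks share the eigenvalue \<open>ln 2\<close>, so the only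
    boundary that matters is where the \<open>Xs\<close> begin.\<close>
  have basis_cases: "j < n - 2 * d + d \<and> U (?J ! j) = ln 2 *\<^sub>R (?J ! j) \<or>
      \<not> j < n - 2 * d + d \<and> U (?J ! j) = 0" if "j < length ?J" for j
  proof -
    define m where "m = n - 2 * d"
    have lZ: "length Zs = m"
      using assms(8) by (simp add: m_def)
    consider "j < m" | "m \<le> j" "j - m < d" | "m \<le> j" "d \<le> j - m"
      by linarith
    then show ?thesis
      unfolding m_def[symmetric]
    proof cases
      case 1
      then show "j < m + d \<and> U (?J ! j) = ln 2 *\<^sub>R (?J ! j) \<or> \<not> j < m + d \<and> U (?J ! j) = 0"
        using lZ Z[of "Zs ! j"] by (auto simp: nth_append)
    next
      case 2
      then show "j < m + d \<and> U (?J ! j) = ln 2 *\<^sub>R (?J ! j) \<or> \<not> j < m + d \<and> U (?J ! j) = 0"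
        using lZ assms(9) Y[of "Ys ! (j - m)"] by (auto simp: nth_append)
    next
      case 3
      then show "j < m + d \<and> U (?J ! j) = ln 2 *\<^sub>R (?J ! j) \<or> \<not> j < m + d \<and> U (?J ! j) = 0"
        using lZ assms(9,10) that X[of "Xs ! (j - m - d)"] by (auto simp: nth_append)
    qed
  qed
  have "ad U (?J ! j) = (if j < n - 2 * d then ln 2 else if j < n - 2 * d + d then ln 2 else 0)
      *\<^sub>R (?J ! j)" if "j < length ?J" for j
    using basis_cases[OF that] by (auto simp: ad_def)
  then have "basis_matrix ?J (ad U) = diag_block_mat
      [ln 2 \<cdot>\<^sub>m 1\<^sub>m (n - 2 * d), ln 2 \<cdot>\<^sub>m 1\<^sub>m d, 0 \<cdot>\<^sub>m 1\<^sub>m d]"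
    unfolding diag_block_mat_scalar_blocks len[symmetric] by (rule basis_matrix_eigenbasis[OF ob])
  \<comment> \<open>By \<open>Ad1\<close>, eigenvalue \<open>ln 2\<close> becomes
    \<open>1 + ln 2 / ln 2 = 2\<close>, and eigenvalue 0 becomes 1.\<close>
  moreover have "Ad_exp U (?J ! j) =
      (if j < n - 2 * d then 2 else if j < n - 2 * d + d then 2 else 1) *\<^sub>R (?J ! j)"
    if "j < length ?J" for j
    using basis_cases[OF that] by (auto simp: Ad1 scaleR_2)
  then have "basis_matrix ?J (Ad_exp U) = diag_block_mat
      [2 \<cdot>\<^sub>m 1\<^sub>m (n - 2 * d), 2 \<cdot>\<^sub>m 1\<^sub>m d, 1 \<cdot>\<^sub>m 1\<^sub>m d]"
    unfolding diag_block_mat_scalar_blocks len[symmetric] by (rule basis_matrix_eigenbasis[OF ob])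
  moreover have "0 \<cdot>\<^sub>m 1\<^sub>m d = (0\<^sub>m d d :: real Matrix.mat)" "1 \<cdot>\<^sub>m 1\<^sub>m d = (1\<^sub>m d :: real Matrix.mat)"
    by auto
  moreover have "((\<lambda>t. Ad_exp (\<lambda>V. t *\<^sub>R U V) W) has_vector_derivative ad U W) (at 0)" for W
    unfolding Ad_exp_def ad_def by (rule lin_exp_scaled_has_vector_derivative[OF lin UU]) simp
  ultimately show ?thesis
    using matrix_representation_basis_matrix[OF ob] by auto
qed

end
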